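(* Let $\mathbf{X}$ be a random vector distributed with density $f_\infty(|\mathbf{x}|)$, $\mathbf{x}\in\mathbb{R}^n$, where the probability density function $f_\infty(|\mathbf{x}|)$ satisfies the differential equation $$\nabla\left[K(|\mathbf{x}|)f_\infty(|\mathbf{x}|)\right]+\mathbf{x}\,f_\infty(|\mathbf{x}|)=0$$ with a positive weight function $K$. Suppose moreover that there exists a real value $R>0$ such that, for any $r\ge R$, the weight function $K(r)$ satisfies the inequality $$(n-1)\frac{K(r)}{r^2}\le\frac12 .$$ Then, for any smooth function $\phi$ on $\mathbb{R}^n$, supported outside the ball $B_R=\{\mathbf{x}\in\mathbb{R}^n:\ |\mathbf{x}|\le R\}$, and with finite variance with respect to $f_\infty(|\mathbf{x}|)$, we have $$\int_{\mathbb{R}^n}\phi^2(\mathbf{x})f_\infty(|\mathbf{x}|)\,d\mathbf{x}-\left(\int_{\mathbb{R}^n}\phi(\mathbf{y})f_\infty(|\mathbf{y}|)\,d\mathbf{y}\right)^2\le 2\int_{\mathbb{R}^n}K(|\mathbf{x}|)\,|\nabla\phi(\mathbf{x})|^2 f_\infty(|\mathbf{x}|)\,d\mathbf{x}.$$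
   Context: "Supported outside the ball $B_R$" means $\phi(\mathbf{x})=0$ for $|\mathbf{x}|\le R$. The variance of $\phi$ with respect to $f_\infty$ is $\int_{\mathbb{R}^n}\left(\phi(\mathbf{x})-\int_{\mathbb{R}^n}\phi(\mathbf{y})f_\infty(|\mathbf{y}|)\,d\mathbf{y}\right)^2 f_\infty(|\mathbf{x}|)\,d\mathbf{x}$. The inequality is understood in the following sense: if the right-hand side is finite, then the inequality holds. *)

theory Defs
  imports "HOL-Probability.Probability"
begin

text \<open>
  \<^term>\<open>frechet_derivative\<close> is a meaningful value only at points of differentiability, so the
  definitions and statements below pair \<^term>\<open>partial_deriv\<close> and \<^term>\<open>gradient\<close> with a
  differentiability condition.
\<close>

definition partial_deriv :: "'n \<Rightarrow> (real ^ 'n \<Rightarrow> real) \<Rightarrow> real ^ 'n \<Rightarrow> real"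
  where "partial_deriv i f x = frechet_derivative f (at x) (axis i 1)"

definition gradient :: "(real ^ 'n \<Rightarrow> real) \<Rightarrow> real ^ 'n \<Rightarrow> real ^ 'n"
  where "gradient f x = (\<chi> i. partial_deriv i f x)"

lemma GDERIV_iff_gradient:
  fixes f :: "real ^ 'n \<Rightarrow> real"
  shows "GDERIV f x :> D \<longleftrightarrow> f differentiable (at x) \<and> gradient f x = D"
proof
  assume "GDERIV f x :> D"
  then have der: "(f has_derivative (\<lambda>h. h \<bullet> D)) (at x)"
    by (simp add: gderiv_def)
  then have "frechet_derivative f (at x) = (\<lambda>h. h \<bullet> D)"
    by (metis frechet_derivative_at)
  with der show "f differentiable (at x) \<and> gradient f x = D"
    by (auto simp: differentiable_def gradient_def partial_deriv_def vec_eq_iff inner_axis')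
next
  assume *: "f differentiable (at x) \<and> gradient f x = D"
  then have der: "(f has_derivative frechet_derivative f (at x)) (at x)"
    by (simp add: frechet_derivative_works)
  then have lin: "linear (frechet_derivative f (at x))"
    by (rule has_derivative_linear)
  have "frechet_derivative f (at x) h = h \<bullet> D" for h
  proof -
    have "frechet_derivative f (at x) h
        = frechet_derivative f (at x) (\<Sum>i\<in>UNIV. h $ i *\<^sub>R axis i 1)"
      using basis_expansion[of h] by (simp add: scalar_mult_eq_scaleR)
    also have "\<dots> = (\<Sum>i\<in>UNIV. h $ i * frechet_derivative f (at x) (axis i 1))"
      by (simp add: linear_sum[OF lin] linear_cmul[OF lin])
    also have "\<dots> = h \<bullet> D"
      using * by (auto simp: gradient_def partial_deriv_def inner_vec_def)
    finally show ?thesis .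
  qed
  then have "frechet_derivative f (at x) = (\<lambda>h. h \<bullet> D)"
    by blast
  with der show "GDERIV f x :> D"
    by (simp add: gderiv_def)
qed

primrec Ck :: "nat \<Rightarrow> (real ^ 'n \<Rightarrow> real) \<Rightarrow> bool"
  where
    "Ck 0 f \<longleftrightarrow> continuous_on UNIV f"
  | "Ck (Suc k) f \<longleftrightarrow> f differentiable_on UNIV \<and> (\<forall>i. Ck k (partial_deriv i f))"

definition smooth :: "(real ^ 'n \<Rightarrow> real) \<Rightarrow> bool"
  where "smooth f \<longleftrightarrow> (\<forall>k. Ck k f)"

text \<open>
  In the following, \<open>f\<close> is the radial profile: the density at \<open>x\<close> is \<open>f (norm x)\<close>. The
  integrability conjuncts are needed since the Bochner integral of a non-integrable function is \<open>0\<close>.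
\<close>

definition mean_wrt :: "(real \<Rightarrow> real) \<Rightarrow> (real ^ 'n \<Rightarrow> real) \<Rightarrow> real"
  where "mean_wrt f \<phi> = (LINT y|lborel. \<phi> y * f (norm y))"

definition finite_variance_wrt :: "(real \<Rightarrow> real) \<Rightarrow> (real ^ 'n \<Rightarrow> real) \<Rightarrow> bool"
  where "finite_variance_wrt f \<phi> \<longleftrightarrow>
    integrable lborel (\<lambda>y. \<phi> y * f (norm y)) \<and>
    integrable lborel (\<lambda>x. (\<phi> x - mean_wrt f \<phi>)\<^sup>2 * f (norm x))"

end

theory Submission
  imports Defs
begin

text \<open>
  Write \<open>n\<close> for the dimension, \<open>p\<close> for the density and \<open>P = K p\<close>. The equation reads
  \<open>\<nabla>P = - p x\<close>, so that \<open>p = - x \<bullet> \<nabla>P / |x|\<^sup>2\<close>. Integrating \<open>\<phi>\<^sup>2 p\<close> by parts against the radial field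
  \<open>x / |x|\<^sup>2\<close>, whose divergence is \<open>(n - 2) / |x|\<^sup>2\<close>, gives
  \<open>\<integral>\<phi>\<^sup>2 p = \<integral>P (2 \<phi> (x \<bullet> \<nabla>\<phi>) + (n - 2) \<phi>\<^sup>2) / |x|\<^sup>2\<close>; the field is singular only at the origin,
  where \<open>\<phi>\<close> vanishes. By Cauchy--Schwarz \<open>2 \<phi> (x \<bullet> \<nabla>\<phi>) \<le> \<phi>\<^sup>2 + |x|\<^sup>2 |\<nabla>\<phi>|\<^sup>2\<close>, which turns \<open>n - 2\<close>
  into \<open>n - 1\<close>, and the hypothesis \<open>(n - 1) P / |x|\<^sup>2 \<le> p / 2\<close> absorbs that term into half of the
  left-hand side. What remains is \<open>\<integral>\<phi>\<^sup>2 p \<le> 2 \<integral>P |\<nabla>\<phi>|\<^sup>2\<close>, in fact without subtracting the squared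
  mean.

  Two points need care. First, \<open>p\<close> is only measurable, so the classical divergence theorem for
  continuously differentiable fields does not apply. For a field \<open>W x\<close> with scalar \<open>W\<close>, however,
  \<open>\<integral>div (W x) = 0\<close> is the infinitesimal form of the dilation invariance of Lebesgue measure
  (\<open>integral_divergence_radial_eq_0\<close>), and there the fundamental theorem of calculus is used only
  along rays, where it holds for every derivative. Second, no decay of
  \<open>\<phi>\<close> or \<open>P\<close> at infinity is given. A radially decreasing cutoff makes everything compactly supported
  (\<open>truncated_Poincare_outside_ball\<close>), and the term containing its derivative has the favourable
  sign, so it can be dropped before the cutoff is removed.
\<close>

section \<open>Integral of the divergence of a radial field\<close>

lemma lborel_dilation_integral:
  fixes g :: "'a::euclidean_space \<Rightarrow> real"
  assumes g: "integrable lborel g" and c: "c > 0"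
  shows "integrable lborel (\<lambda>x. c ^ DIM('a) * g (c *\<^sub>R x))"
    and "(LINT x|lborel. c ^ DIM('a) * g (c *\<^sub>R x)) = (LINT x|lborel. g x)"
proof -
  let ?N = "density (distr lborel borel (\<lambda>x::'a. 0 + c *\<^sub>R x)) (\<lambda>_. \<bar>c\<bar> ^ DIM('a))"
  have N: "lborel = ?N"
    using c lborel_affine[of c "0::'a"] by simp
  have gm [measurable]: "g \<in> borel_measurable borel"
    using borel_measurable_integrable[OF g] by simp
  have "integrable ?N g"
    using g N by simp
  then show "integrable lborel (\<lambda>x. c ^ DIM('a) * g (c *\<^sub>R x))"
    using c by (simp add: integrable_density integrable_distr_eq)
  have "integral\<^sup>L ?N g = (LINT x|lborel. c ^ DIM('a) * g (c *\<^sub>R x))"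
    using c by (simp add: integral_density integral_distr)
  then show "(LINT x|lborel. c ^ DIM('a) * g (c *\<^sub>R x)) = (LINT x|lborel. g x)"
    using N by simp
qed

text \<open>
  The integral of \<open>exp t ^ n * W (exp t *\<^sub>R x)\<close> over \<open>x\<close> does not depend on \<open>t\<close>, and its
  \<open>t\<close>-derivative is the integral of the dilated divergence \<open>n W + x \<bullet> \<nabla>W\<close>, which does not depend
  on \<open>t\<close> either. To differentiate under the integral without any continuity of the divergence, the
  argument integrates over \<open>t\<close> between 0 and 1 and exchanges the integrals by Fubini.
\<close>

lemma integral_divergence_radial_eq_0:
  fixes W :: "'a::euclidean_space \<Rightarrow> real" and W' :: "'a \<Rightarrow> 'a \<Rightarrow> real"
  assumes W: "integrable lborel W"
    and D: "integrable lborel (\<lambda>x. real DIM('a) * W x + W' x x)"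
    and der: "\<And>x. x \<noteq> 0 \<Longrightarrow> (W has_derivative W' x) (at x)"
  shows "(LINT x|lborel. real DIM('a) * W x + W' x x) = 0"
proof -
  define D where "D = (\<lambda>x. real DIM('a) * W x + W' x x)"
  have iD: "integrable lborel D"
    using D by (simp add: D_def)
  have [measurable]: "D \<in> borel_measurable borel"
    using borel_measurable_integrable[OF iD] by simp
  define F where "F = (\<lambda>t x. exp t ^ DIM('a) * W (exp t *\<^sub>R x))"
  define h where "h = (\<lambda>(t, x). indicator {0..1::real} t * (exp t ^ DIM('a) * D (exp t *\<^sub>R x)))"
  have inner: "(LINT x|lborel. h (t, x)) = indicator {0..1} t * (LINT x|lborel. D x)" for t
    using lborel_dilation_integral(2)[OF iD, of "exp t"] by (simp add: h_def)
  have ih: "integrable (lborel \<Otimes>\<^sub>M lborel) h"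
  proof (rule lborel_pair.Fubini_integrable)
    show "h \<in> borel_measurable (lborel \<Otimes>\<^sub>M lborel)"
      unfolding h_def by measurable
    have "integrable lborel (\<lambda>x. \<bar>D x\<bar>)"
      using iD by simp
    from lborel_dilation_integral(2)[OF this]
    have "(LINT x|lborel. norm (h (t, x))) = indicator {0..1} t * (LINT x|lborel. \<bar>D x\<bar>)" for t
      by (simp add: h_def abs_mult)
    moreover have "integrable lborel (\<lambda>t. indicator {0..1::real} t * (LINT x|lborel. \<bar>D x\<bar>))"
      by (intro integrable_mult_left integrable_real_indicator) auto
    ultimately show "integrable lborel (\<lambda>t. LINT x|lborel. norm (h (t, x)))"
      by simp
    show "AE t in lborel. integrable lborel (\<lambda>x. h (t, x))"
      using lborel_dilation_integral(1)[OF iD] by (simp add: h_def)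
  qed
  have ray: "((\<lambda>t. F t x) has_vector_derivative exp t ^ DIM('a) * D (exp t *\<^sub>R x)) (at t within S)"
    if "x \<noteq> 0" for t S and x :: 'a
  proof -
    have [derivative_intros]: "((\<lambda>t. W (exp t *\<^sub>R x)) has_derivative
        (\<lambda>s. W' (exp t *\<^sub>R x) (s *\<^sub>R (exp t *\<^sub>R x)))) (at t within S)"
    proof (rule has_derivative_compose[where g = W])
      show "((\<lambda>t. exp t *\<^sub>R x) has_derivative (\<lambda>s. s *\<^sub>R (exp t *\<^sub>R x))) (at t within S)"
        by (auto intro!: derivative_eq_intros)
    qed (use der that in auto)
    have lin: "W' (exp t *\<^sub>R x) (s *\<^sub>R y) = s * W' (exp t *\<^sub>R x) y" for s y
      using linear_scale[OF has_derivative_linear[OF der]] that by simp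
    have e: "exp t ^ DIM('a) = exp t ^ (DIM('a) - Suc 0) * exp t"
      by (metis DIM_positive Suc_pred' One_nat_def power_Suc2)
    show ?thesis
      unfolding F_def has_vector_derivative_def D_def
      by (auto intro!: derivative_eq_intros simp: lin fun_eq_iff e algebra_simps)
  qed
  have along_rays: "AE x in lborel. (LINT t|lborel. h (t, x)) = exp 1 ^ DIM('a) * W (exp 1 *\<^sub>R x) - W x"
  proof -
    have "AE x in lborel. integrable lborel (\<lambda>t. h (t, x))"
      using lborel_pair.AE_integrable_snd[of "\<lambda>t x. h (t, x)"] ih by simp
    moreover have "AE x in lborel. x \<noteq> (0::'a)"
      by (rule AE_lborel_singleton)
    ultimately show ?thesis
    proof eventually_elim
      case (elim x)
      have "((\<lambda>t. exp t ^ DIM('a) * D (exp t *\<^sub>R x)) has_integral F 1 x - F 0 x) {0..1}"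
        by (rule fundamental_theorem_of_calculus) (use ray elim in auto)
      then have "((\<lambda>t. h (t, x)) has_integral F 1 x - F 0 x) UNIV"
        unfolding h_def by (subst (asm) has_integral_restrict_UNIV[symmetric])
          (simp add: indicator_def of_bool_def if_distrib[of "\<lambda>a. a * _"] cong: if_cong)
      from has_integral_unique[OF has_integral_integral_lborel[OF elim(1)] this]
      show ?case
        by (simp add: F_def)
    qed
  qed
  have "(LINT x|lborel. D x) = (LINT t|lborel. LINT x|lborel. h (t, x))"
    by (simp add: inner)
  also have "\<dots> = (LINT x|lborel. LINT t|lborel. h (t, x))"
    using lborel_pair.Fubini_integral[of "\<lambda>t x. h (t, x)"] ih by simp
  also have "\<dots> = (LINT x|lborel. exp 1 ^ DIM('a) * W (exp 1 *\<^sub>R x) - W x)"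
  proof (rule integral_cong_AE[OF _ _ along_rays])
    have [measurable]: "h \<in> borel_measurable (lborel \<Otimes>\<^sub>M lborel)" "W \<in> borel_measurable borel"
      using ih W by auto
    show "(\<lambda>x. LINT t|lborel. h (t, x)) \<in> borel_measurable lborel"
      by measurable
  qed (use W in measurable)
  also have "\<dots> = 0"
    using lborel_dilation_integral[OF W, of "exp 1"] W by simp
  finally show ?thesis
    by (simp add: D_def)
qed

section \<open>A radially decreasing cutoff\<close>

text \<open>
  The square makes this continuously differentiable at \<open>u = 1\<close>. It is applied to
  \<open>u = |x|\<^sup>2 / T\<^sup>2\<close>.
\<close>

definition cutoff :: "real \<Rightarrow> real"
  where "cutoff u = (max 0 (1 - u))\<^sup>2"

lemma DERIV_cutoff: "(cutoff has_real_derivative - 2 * max 0 (1 - u)) (at u)"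
proof (cases "u = 1")
  case False
  have "eventually (\<lambda>v. (if u < 1 then (1 - v)\<^sup>2 else 0) = cutoff v) (nhds u)"
  proof (cases "u < 1")
    case True
    then show ?thesis
      using eventually_nhds_in_open[of "{..<1}" u] by (auto elim!: eventually_mono simp: cutoff_def)
  next
    case 2: False
    with False show ?thesis
      using eventually_nhds_in_open[of "{1<..}" u] by (auto elim!: eventually_mono simp: cutoff_def)
  qed
  moreover have "((\<lambda>v. if u < 1 then (1 - v)\<^sup>2 else 0) has_real_derivative - 2 * max 0 (1 - u)) (at u)"
    by (cases "u < 1") (auto intro!: derivative_eq_intros)
  ultimately show ?thesis
    by (subst (asm) DERIV_cong_ev) auto
next
  case True
  have "((\<lambda>h. (cutoff (1 + h) - cutoff 1) / h) \<longlongrightarrow> 0) (at 0)"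
  proof (rule Lim_null_comparison)
    show "\<forall>\<^sub>F h in at 0. norm ((cutoff (1 + h) - cutoff 1) / h) \<le> \<bar>h\<bar>"
      by (auto simp: cutoff_def power2_eq_square max_def intro!: always_eventually)
    show "((\<lambda>h::real. \<bar>h\<bar>) \<longlongrightarrow> 0) (at 0)"
      by (intro tendsto_eq_intros) auto
  qed
  with True show ?thesis
    by (simp add: DERIV_def)
qed

lemma cutoff_bounds: "u \<ge> 0 \<Longrightarrow> 0 \<le> cutoff u \<and> cutoff u \<le> 1"
  by (auto simp: cutoff_def power_le_one)

lemma cutoff_eq_0: "u \<ge> 1 \<Longrightarrow> cutoff u = 0"
  by (simp add: cutoff_def)

lemma continuous_cutoff: "continuous_on S cutoff"
  unfolding cutoff_def by (intro continuous_intros)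


section \<open>The weighted inequality outside a ball\<close>

lemma integrable_continuous_compact_support:
  fixes u :: "'a::euclidean_space \<Rightarrow> real"
  assumes "compact S" "continuous_on UNIV u" "\<And>x. x \<notin> S \<Longrightarrow> u x = 0"
  shows "integrable lborel u"
proof -
  have "(\<lambda>x. indicator S x *\<^sub>R u x) = u"
    using assms(3) by (fastforce simp: indicator_def)
  with borel_integrable_compact[OF assms(1) continuous_on_subset[OF assms(2)]] show ?thesis
    by simp
qed

text \<open>
  The divergence lemma is applied to \<open>W = c \<phi>\<^sup>2 P / |x|\<^sup>2\<close> with \<open>c\<close> the cutoff at radius \<open>T\<close>. Its
  divergence consists of \<open>- c \<phi>\<^sup>2 p\<close>, coming from \<open>\<nabla>P\<close> and dominated by the integrable \<open>\<phi>\<^sup>2 p\<close>, and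
  of terms that are continuous with compact support, collected in \<open>E\<close>. The bound on
  \<open>(n - 1) P / |x|\<^sup>2\<close> could not replace the cutoff here: in dimension one it says nothing about the
  integrability of \<open>\<phi>\<^sup>2 P / |x|\<^sup>2\<close>.
\<close>

lemma truncated_Poincare_outside_ball:
  fixes p P \<phi> :: "'a::euclidean_space \<Rightarrow> real" and \<phi>' :: "'a \<Rightarrow> 'a"
  assumes P0: "\<And>x. P x \<ge> 0"
    and dP: "\<And>x. GDERIV P x :> - (p x *\<^sub>R x)"
    and d\<phi>: "\<And>x. GDERIV \<phi> x :> \<phi>' x" and c\<phi>': "continuous_on UNIV \<phi>'"
    and R: "R > 0" and supp: "\<And>x. norm x \<le> R \<Longrightarrow> \<phi> x = 0"
    and bound: "\<And>x. norm x \<ge> R \<Longrightarrow> (real DIM('a) - 1) * (P x / (norm x)\<^sup>2) \<le> p x / 2"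
    and i2: "integrable lborel (\<lambda>x. (\<phi> x)\<^sup>2 * p x)"
    and iE: "integrable lborel (\<lambda>x. P x * (norm (\<phi>' x))\<^sup>2)"
    and T: "T > 0"
  shows "(LINT x|lborel. cutoff ((norm x)\<^sup>2 / T\<^sup>2) * ((\<phi> x)\<^sup>2 * p x))
      \<le> 2 * (LINT x|lborel. P x * (norm (\<phi>' x))\<^sup>2)"
proof -
  define n where "n = real DIM('a)"
  define c where "c = (\<lambda>x::'a. cutoff ((norm x)\<^sup>2 / T\<^sup>2))"
  define c' where "c' = (\<lambda>x::'a. - 2 * max 0 (1 - (norm x)\<^sup>2 / T\<^sup>2))"
  have c01: "0 \<le> c x" "c x \<le> 1" for x
    using cutoff_bounds[of "(norm x)\<^sup>2 / T\<^sup>2"] by (auto simp: c_def)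
  have outside: "c x = 0" "c' x = 0" if "x \<notin> cball 0 T" for x
  proof -
    have "(norm x)\<^sup>2 / T\<^sup>2 \<ge> 1"
      using that T by (simp add: power_mono)
    then show "c x = 0" "c' x = 0"
      by (simp_all add: c_def c'_def cutoff_eq_0)
  qed
  have cc: "continuous_on UNIV c" "continuous_on UNIV c'"
    unfolding c_def c'_def cutoff_def using T by (intro continuous_intros; simp)+
  have cP: "continuous_on UNIV P" and c\<phi>: "continuous_on UNIV \<phi>"
    using dP d\<phi> unfolding gderiv_def
    by (meson continuous_at_imp_continuous_on has_derivative_continuous)+
  have [measurable]: "c \<in> borel_measurable borel"
    using cc by (auto intro: borel_measurable_continuous_onI)
  \<comment> \<open>\<open>q\<close> is a globally continuous substitute for \<open>1 / |x|\<^sup>2\<close>, equal to it wherever \<open>\<phi>\<close> is nonzero.\<close>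
  define q where "q = (\<lambda>x::'a. 1 / (max R (norm x))\<^sup>2)"
  have cq: "continuous_on UNIV q"
    unfolding q_def using R by (intro continuous_intros) (auto simp: max_def)
  have q: "\<phi> x = 0 \<or> q x = 1 / (norm x)\<^sup>2" for x
    using supp[of x] by (auto simp: q_def)
  define W where "W = (\<lambda>x. c x * (\<phi> x)\<^sup>2 * P x / (norm x)\<^sup>2)"
  have W_q: "W x = c x * (\<phi> x)\<^sup>2 * P x * q x" for x
    using q[of x] by (auto simp: W_def)
  have iW: "integrable lborel W"
    by (rule integrable_continuous_compact_support[of "cball 0 T"])
      (use cc cP c\<phi> cq outside in \<open>auto simp: W_q intro!: continuous_intros\<close>)
  define E where "E = (\<lambda>x. (n - 2) * W x + 2 * c' x * (\<phi> x)\<^sup>2 * P x / T\<^sup>2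
      + 2 * c x * \<phi> x * (x \<bullet> \<phi>' x) * P x * q x)"
  have iE': "integrable lborel E"
    by (rule integrable_continuous_compact_support[of "cball 0 T"])
      (use cc cP c\<phi> c\<phi>' cq outside T in \<open>auto simp: E_def W_q intro!: continuous_intros\<close>)
  have icp: "integrable lborel (\<lambda>x. c x * ((\<phi> x)\<^sup>2 * p x))"
  proof (rule Bochner_Integration.integrable_bound[OF i2])
    show "(\<lambda>x. c x * ((\<phi> x)\<^sup>2 * p x)) \<in> borel_measurable lborel"
      using i2 by measurable
    show "AE x in lborel. norm (c x * ((\<phi> x)\<^sup>2 * p x)) \<le> norm ((\<phi> x)\<^sup>2 * p x)"
    proof (rule AE_I2)
      fix x
      show "norm (c x * ((\<phi> x)\<^sup>2 * p x)) \<le> norm ((\<phi> x)\<^sup>2 * p x)"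
        using c01[of x] mult_right_mono[of "c x" 1 "\<bar>(\<phi> x)\<^sup>2 * p x\<bar>"] by (simp add: abs_mult)
    qed
  qed
  have icE: "integrable lborel (\<lambda>x. c x * (P x * (norm (\<phi>' x))\<^sup>2))"
    by (rule integrable_continuous_compact_support[of "cball 0 T"])
      (use cc cP c\<phi>' outside in \<open>auto intro!: continuous_intros\<close>)
  \<comment> \<open>\<open>V'\<close> is the derivative of the numerator \<open>c \<phi>\<^sup>2 P\<close>, with \<open>\<nabla>P = - p x\<close> inserted;
    \<open>W'\<close> follows by the quotient rule.\<close>
  define V' where "V' = (\<lambda>x h. 2 * (x \<bullet> h) / T\<^sup>2 * c' x * (\<phi> x)\<^sup>2 * P x
      + c x * (2 * \<phi> x * (h \<bullet> \<phi>' x)) * P x - c x * (\<phi> x)\<^sup>2 * (p x * (h \<bullet> x)))"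
  define W' where "W' = (\<lambda>x h. (V' x h * (norm x)\<^sup>2 - c x * (\<phi> x)\<^sup>2 * P x * (2 * (x \<bullet> h)))
      / ((norm x)\<^sup>2 * (norm x)\<^sup>2))"
  have W'_radial: "n * W x + W' x x = E x - c x * ((\<phi> x)\<^sup>2 * p x)" for x
  proof (cases "norm x \<le> R")
    case True
    then show ?thesis
      using supp by (simp add: W_def W'_def V'_def E_def)
  next
    case False
    then have "norm x \<noteq> 0" and "q x = 1 / (norm x)\<^sup>2"
      using R by (auto simp: q_def)
    then show ?thesis
      unfolding W_def W'_def V'_def E_def
      by (simp add: dot_square_norm field_simps power2_eq_square)
  qed
  have dW: "(W has_derivative W' x) (at x)" if "x \<noteq> 0" for x
  proof -
    have [derivative_intros]: "(P has_derivative (\<lambda>h. h \<bullet> - (p x *\<^sub>R x))) (at x)"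
        "(\<phi> has_derivative (\<lambda>h. h \<bullet> \<phi>' x)) (at x)"
      using dP d\<phi> by (auto simp: gderiv_def)
    have ds: "((\<lambda>x::'a. x \<bullet> x) has_derivative (\<lambda>h. 2 * (x \<bullet> h))) (at x)"
      by (auto intro!: derivative_eq_intros simp: inner_commute)
    from bounded_linear.has_derivative[OF bounded_linear_divide this]
    have [derivative_intros]: "(c has_derivative (\<lambda>h. 2 * (x \<bullet> h) / T\<^sup>2 * c' x)) (at x)"
      unfolding c_def c'_def power2_norm_eq_inner by (rule DERIV_compose_FDERIV[OF DERIV_cutoff])
    have "((\<lambda>x. c x * (\<phi> x)\<^sup>2 * P x) has_derivative V' x) (at x)"
      unfolding V'_def by (auto intro!: derivative_eq_intros simp: fun_eq_iff algebra_simps)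
    from has_derivative_divide'[OF this ds] that show ?thesis
      unfolding W_def W'_def power2_norm_eq_inner by simp
  qed
  have pointwise: "E x - c x * ((\<phi> x)\<^sup>2 * p x)
      \<le> c x * (P x * (norm (\<phi>' x))\<^sup>2) - c x * ((\<phi> x)\<^sup>2 * p x) / 2" for x
  proof (cases "norm x \<le> R")
    case True
    then show ?thesis
      using supp c01[of x] P0[of x] by (simp add: E_def W_def)
  next
    case False
    define s where "s = (norm x)\<^sup>2"
    have s: "s > 0" "q x = 1 / s"
      using False R by (auto simp: q_def s_def)
    \<comment> \<open>The cutoff decreases along rays, so its derivative contributes with the right sign.\<close>
    have "c' x * (\<phi> x)\<^sup>2 * P x \<le> 0"
      using P0[of x] by (auto simp: c'_def mult_le_0_iff)
    then have cut: "2 * c' x * (\<phi> x)\<^sup>2 * P x / T\<^sup>2 \<le> 0"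
      using T by (simp add: divide_le_0_iff algebra_simps)
    \<comment> \<open>This weighting in the Cauchy--Schwarz step adds exactly one copy of \<open>\<phi>\<^sup>2 P / |x|\<^sup>2\<close>,
      raising the coefficient \<open>n - 2\<close> to the \<open>n - 1\<close> of the hypothesis.\<close>
    have "2 * \<phi> x * (x \<bullet> \<phi>' x) \<le> 2 * (\<bar>\<phi> x\<bar> * (norm x * norm (\<phi>' x)))"
      using mult_left_mono[OF Cauchy_Schwarz_ineq2[of x "\<phi>' x"], of "\<bar>\<phi> x\<bar>"]
        abs_ge_self[of "\<phi> x * (x \<bullet> \<phi>' x)"] by (simp add: abs_mult)
    also have "\<dots> \<le> (\<phi> x)\<^sup>2 + s * (norm (\<phi>' x))\<^sup>2"
      using sum_squares_bound[of "\<bar>\<phi> x\<bar>" "norm x * norm (\<phi>' x)"]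
      by (simp add: s_def power_mult_distrib)
    finally have "2 * \<phi> x * (x \<bullet> \<phi>' x) * (P x / s) \<le> ((\<phi> x)\<^sup>2 + s * (norm (\<phi>' x))\<^sup>2) * (P x / s)"
      using P0[of x] s by (intro mult_right_mono) auto
    then have cross: "2 * \<phi> x * (x \<bullet> \<phi>' x) * (P x / s) \<le> (\<phi> x)\<^sup>2 * (P x / s) + P x * (norm (\<phi>' x))\<^sup>2"
      using s by (simp add: field_simps)
    have "(\<phi> x)\<^sup>2 * ((n - 1) * (P x / s)) \<le> (\<phi> x)\<^sup>2 * (p x / 2)"
      using bound[of x] False by (intro mult_left_mono) (auto simp: n_def s_def)
    then have "(\<phi> x)\<^sup>2 * ((n - 1) * (P x / s)) \<le> (\<phi> x)\<^sup>2 * p x / 2"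
      by simp
    moreover have "(n - 2) * ((\<phi> x)\<^sup>2 * (P x / s)) + (\<phi> x)\<^sup>2 * (P x / s)
        = (\<phi> x)\<^sup>2 * ((n - 1) * (P x / s))"
      by algebra
    ultimately have "(n - 2) * ((\<phi> x)\<^sup>2 * (P x / s)) + 2 * \<phi> x * (x \<bullet> \<phi>' x) * (P x / s) - (\<phi> x)\<^sup>2 * p x
        \<le> P x * (norm (\<phi>' x))\<^sup>2 - (\<phi> x)\<^sup>2 * p x / 2"
      using cross by linarith
    from mult_left_mono[OF this c01(1)[of x]] cut show ?thesis
      unfolding E_def W_def s_def[symmetric] s(2) by (simp add: algebra_simps)
  qed
  have "0 = (LINT x|lborel. n * W x + W' x x)"
    using integral_divergence_radial_eq_0[OF iW _ dW] iE' icp by (simp flip: n_def add: W'_radial)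
  also have "\<dots> \<le> (LINT x|lborel. c x * (P x * (norm (\<phi>' x))\<^sup>2) - c x * ((\<phi> x)\<^sup>2 * p x) / 2)"
    unfolding W'_radial using iE' icp icE pointwise by (intro integral_mono) auto
  also have "\<dots> = (LINT x|lborel. c x * (P x * (norm (\<phi>' x))\<^sup>2)) - (LINT x|lborel. c x * ((\<phi> x)\<^sup>2 * p x)) / 2"
    using icp icE by simp
  also have "(LINT x|lborel. c x * (P x * (norm (\<phi>' x))\<^sup>2)) \<le> (LINT x|lborel. P x * (norm (\<phi>' x))\<^sup>2)"
    using icE iE c01 P0 by (intro integral_mono) (auto intro!: mult_left_le_one_le)
  finally show ?thesis
    by (simp add: c_def)
qed

text \<open>
  The cutoff is removed on the left by dominated convergence as \<open>T\<close> tends to infinity; the right-hand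
  side of the truncated inequality is already free of \<open>T\<close>.
\<close>

lemma Poincare_outside_ball:
  fixes p P \<phi> :: "'a::euclidean_space \<Rightarrow> real" and \<phi>' :: "'a \<Rightarrow> 'a"
  assumes "\<And>x. P x \<ge> 0"
    and "\<And>x. GDERIV P x :> - (p x *\<^sub>R x)"
    and "\<And>x. GDERIV \<phi> x :> \<phi>' x" and "continuous_on UNIV \<phi>'"
    and "R > 0" and "\<And>x. norm x \<le> R \<Longrightarrow> \<phi> x = 0"
    and "\<And>x. norm x \<ge> R \<Longrightarrow> (real DIM('a) - 1) * (P x / (norm x)\<^sup>2) \<le> p x / 2"
    and i2: "integrable lborel (\<lambda>x. (\<phi> x)\<^sup>2 * p x)"
    and "integrable lborel (\<lambda>x. P x * (norm (\<phi>' x))\<^sup>2)"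
  shows "(LINT x|lborel. (\<phi> x)\<^sup>2 * p x) \<le> 2 * (LINT x|lborel. P x * (norm (\<phi>' x))\<^sup>2)"
proof -
  have [measurable]: "cutoff \<in> borel_measurable borel"
    by (intro borel_measurable_continuous_onI continuous_cutoff)
  let ?c = "\<lambda>k (x::'a). cutoff ((norm x)\<^sup>2 / (real (Suc k))\<^sup>2)"
  have "(\<lambda>k. LINT x|lborel. ?c k x * ((\<phi> x)\<^sup>2 * p x)) \<longlonglongrightarrow> (LINT x|lborel. (\<phi> x)\<^sup>2 * p x)"
  proof (rule integral_dominated_convergence[where w = "\<lambda>x. \<bar>(\<phi> x)\<^sup>2 * p x\<bar>"])
    show "AE x in lborel. (\<lambda>k. ?c k x * ((\<phi> x)\<^sup>2 * p x)) \<longlonglongrightarrow> (\<phi> x)\<^sup>2 * p x"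
    proof (rule AE_I2)
      fix x :: 'a
      have "(\<lambda>k. 1 / real (Suc k)) \<longlonglongrightarrow> 0"
        using LIMSEQ_inverse_real_of_nat by (simp add: field_simps)
      then have "(\<lambda>k. (norm x)\<^sup>2 * (1 / real (Suc k))\<^sup>2) \<longlonglongrightarrow> (norm x)\<^sup>2 * 0\<^sup>2"
        by (intro tendsto_intros)
      then have "(\<lambda>k. ?c k x) \<longlonglongrightarrow> cutoff 0"
        by (intro isCont_tendsto_compose[of 0 cutoff])
          (use continuous_cutoff[of UNIV] in \<open>auto simp: continuous_on_eq_continuous_at power_divide\<close>)
      from tendsto_mult_right[OF this, of "(\<phi> x)\<^sup>2 * p x"]
      show "(\<lambda>k. ?c k x * ((\<phi> x)\<^sup>2 * p x)) \<longlonglongrightarrow> (\<phi> x)\<^sup>2 * p x"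
        by (simp add: cutoff_def)
    qed
    show "AE x in lborel. norm (?c k x * ((\<phi> x)\<^sup>2 * p x)) \<le> \<bar>(\<phi> x)\<^sup>2 * p x\<bar>" for k
    proof (rule AE_I2)
      fix x
      show "norm (?c k x * ((\<phi> x)\<^sup>2 * p x)) \<le> \<bar>(\<phi> x)\<^sup>2 * p x\<bar>"
        using cutoff_bounds[of "(norm x)\<^sup>2 / (real (Suc k))\<^sup>2"]
          mult_right_mono[of "?c k x" 1 "\<bar>(\<phi> x)\<^sup>2 * p x\<bar>"] by (simp add: abs_mult)
    qed
  next
    show "integrable lborel (\<lambda>x. \<bar>(\<phi> x)\<^sup>2 * p x\<bar>)"
      using i2 by (rule integrable_abs)
  qed (use i2 in measurable)
  then show ?thesis
    by (rule LIMSEQ_le_const2) (use truncated_Poincare_outside_ball[OF assms] in simp)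
qed

section \<open>Radial densities\<close>

lemma smooth_imp_GDERIV:
  assumes "smooth \<phi>"
  shows "GDERIV \<phi> x :> gradient \<phi> x" and "continuous_on UNIV (gradient \<phi>)"
proof -
  have *: "Ck (Suc 0) \<phi>"
    using assms unfolding smooth_def by blast
  then show "GDERIV \<phi> x :> gradient \<phi> x"
    by (simp add: GDERIV_iff_gradient differentiable_on_def)
  show "continuous_on UNIV (gradient \<phi>)"
    unfolding gradient_def[abs_def] using * by (intro continuous_on_vec_lambda) simp
qed

theorem proposition15:
  fixes M :: "'s measure"
    and X :: "'s \<Rightarrow> real ^ 'n"
    and f K :: "real \<Rightarrow> real"
    and R :: real
    and \<phi> :: "real ^ 'n \<Rightarrow> real"
  assumes "prob_space M"
    and "distributed M lborel X (\<lambda>x. ennreal (f (norm x)))"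
    and "\<And>r. r \<ge> 0 \<Longrightarrow> f r \<ge> 0"
    and "\<And>r. r \<ge> 0 \<Longrightarrow> K r > 0"
    and "\<And>x :: real ^ 'n. (\<lambda>y :: real ^ 'n. K (norm y) * f (norm y)) differentiable (at x)"
    and "\<And>x :: real ^ 'n.
          gradient (\<lambda>y. K (norm y) * f (norm y)) x + f (norm x) *\<^sub>R x = 0"
    and "R > 0"
    and "\<And>r. r \<ge> R \<Longrightarrow> (real CARD('n) - 1) * (K r / r\<^sup>2) \<le> 1 / 2"
    and "smooth \<phi>"
    and "\<And>x. norm x \<le> R \<Longrightarrow> \<phi> x = 0"
    and "finite_variance_wrt f \<phi>"
    and "integrable lborel (\<lambda>x. K (norm x) * (norm (gradient \<phi> x))\<^sup>2 * f (norm x))"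
  shows "(LINT x|lborel. (\<phi> x)\<^sup>2 * f (norm x)) - (LINT y|lborel. \<phi> y * f (norm y))\<^sup>2
      \<le> 2 * (LINT x|lborel. K (norm x) * (norm (gradient \<phi> x))\<^sup>2 * f (norm x))"
proof -
  have f0: "f (norm x) \<ge> 0" for x :: "real ^ 'n"
    using assms(3) by simp
  have if1: "integrable lborel (\<lambda>x :: real ^ 'n. f (norm x))"
    using distributed_integrable[OF assms(2), of "\<lambda>_. 1"] f0 prob_space.finite_measure[OF assms(1)]
    by (simp add: finite_measure.integrable_const)
  define m where "m = mean_wrt f \<phi>"
  \<comment> \<open>Finite variance gives a finite second moment, by expanding the square around the mean.\<close>
  have "integrable lborel (\<lambda>x. (\<phi> x - m)\<^sup>2 * f (norm x) + 2 * m * (\<phi> x * f (norm x)) - m\<^sup>2 * f (norm x))"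
    using assms(11) if1 unfolding finite_variance_wrt_def m_def by simp
  then have i2: "integrable lborel (\<lambda>x. (\<phi> x)\<^sup>2 * f (norm x))"
    by (simp add: power2_eq_square algebra_simps)
  have "(LINT x|lborel. (\<phi> x)\<^sup>2 * f (norm x))
      \<le> 2 * (LINT x|lborel. K (norm x) * f (norm x) * (norm (gradient \<phi> x))\<^sup>2)"
  proof (rule Poincare_outside_ball[where R = R])
    show "GDERIV (\<lambda>x. K (norm x) * f (norm x)) x :> - (f (norm x) *\<^sub>R x)" for x :: "real ^ 'n"
      using assms(5,6)[of x] by (simp add: GDERIV_iff_gradient eq_neg_iff_add_eq_0)
    show "(real DIM(real ^ 'n) - 1) * (K (norm x) * f (norm x) / (norm x)\<^sup>2) \<le> f (norm x) / 2"
      if "norm x \<ge> R" for x :: "real ^ 'n"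
      using mult_right_mono[OF assms(8)[OF that] f0[of x]] by simp
    show "integrable lborel (\<lambda>x. K (norm x) * f (norm x) * (norm (gradient \<phi> x))\<^sup>2)"
      using assms(12) by (simp add: mult_ac)
  qed (use assms(7,10) assms(4)[THEN less_imp_le] f0 i2 smooth_imp_GDERIV[OF assms(9)] in auto)
  also have "(LINT x|lborel. K (norm x) * f (norm x) * (norm (gradient \<phi> x))\<^sup>2)
      = (LINT x|lborel. K (norm x) * (norm (gradient \<phi> x))\<^sup>2 * f (norm x))"
    by (simp add: mult_ac)
  finally show ?thesis
    using zero_le_power2[of "LINT y|lborel. \<phi> y * f (norm y)"] by linarith
qed

end
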